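(* Let $\mathcal{P}_A,\mathcal{P}_B\in(0,1)$ and let $\mathcal{G}_A=G(\mathcal{P}_A)$, $\mathcal{G}_B=G(\mathcal{P}_B)$ be the corresponding probabilities that $A$, respectively $B$, wins a game on own serve. Assume $\mathcal{G}_A+\mathcal{G}_B>1$. For $\sigma\in\{A,B\}$ let $T^{\mathrm{set}}_\sigma$ denote the expected total number of games in a set in which $\sigma$ serves first. If $\mathcal{G}_A>\mathcal{G}_B$, then $T^{\mathrm{set}}_A<T^{\mathrm{set}}_B$.
   Context: Tennis model with constant serve-point probabilities. Two players $A,B$ play. Each point is won by the player $\sigma\in\{A,B\}$ serving it with probability $\mathcal{P}_\sigma$, independently of all other points. A (non-tiebreak) game served by $\sigma$ is won by $\sigma$ with probability $\mathcal{G}_\sigma=G(\mathcal{P}_\sigma)$, where $$G(x)=x^4\left(15-4x-\frac{10x^2}{1-2x(1-x)}\right),$$ and distinct games are independent. Set: the players alternate serving games, starting with the first server of the set. The set is won by the first player to have won at least 6 games with a lead of at least 2 games; if the score reaches 6-6 a tiebreak is played, which decides the set (final score 7-6) and counts as one game (the 13th), won by the tiebreak winner. Hence the possible final scores are 6-0, 6-1, 6-2, 6-3, 6-4, 7-5, 7-6 in favour of either player, and the total number of games is the sum of the two numbers in the score. Tiebreak: the first server of the set serves the first point of the tiebreak; then the opponent serves two points, then the first server two points, and so on alternately in blocks of two; the tiebreak is won by the first player with at least 7 points and a lead of at least 2 points. *)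

theory Defs
  imports "HOL-Probability.Probability"
begin

datatype player = PlayerA | PlayerB

fun opponent :: "player \<Rightarrow> player" where
  "opponent PlayerA = PlayerB"
| "opponent PlayerB = PlayerA"

definition game_prob :: "real \<Rightarrow> real" where
  "game_prob x = x ^ 4 * (15 - 4 * x - 10 * x\<^sup>2 / (1 - 2 * x * (1 - x)))"

text \<open>Winner of a point or game served by \<open>s\<close>, where \<open>q s\<close> is the probability that the server
  wins. \<open>bernoulli_pmf\<close> clips its argument to \<open>[0,1]\<close>, which has no effect for \<open>q = P\<close> and
  \<open>q = game_prob \<circ> P\<close> with \<open>P\<close> valued in \<open>(0,1)\<close>.\<close>

definition winner_pmf :: "(player \<Rightarrow> real) \<Rightarrow> player \<Rightarrow> player pmf" where
  "winner_pmf q s = map_pmf (\<lambda>b. if b then s else opponent s) (bernoulli_pmf (q s))"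

text \<open>Games and tiebreak points are numbered from 0. The tiebreak servers are
  \<open>s, s', s', s, s, s', s', \<dots>\<close> with \<open>s'\<close> the opponent of \<open>s\<close>.\<close>

definition game_server :: "player \<Rightarrow> nat \<Rightarrow> player" where
  "game_server s n = (if even n then s else opponent s)"

definition tiebreak_server :: "player \<Rightarrow> nat \<Rightarrow> player" where
  "tiebreak_server s n = (if even ((n + 1) div 2) then s else opponent s)"

text \<open>A sample point is a pair \<open>(g, t)\<close>: \<open>g n\<close> is the winner of game \<open>n\<close>, and \<open>t n\<close> the winner of
  tiebreak point \<open>n\<close>. Both sequences are infinite; entries after the end of the set (of the
  tiebreak) are simply not used.\<close>

definition set_space ::
    "(player \<Rightarrow> real) \<Rightarrow> player \<Rightarrow> ((nat \<Rightarrow> player) \<times> (nat \<Rightarrow> player)) measure" where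
  "set_space P s =
     (\<Pi>\<^sub>M n\<in>UNIV. measure_pmf (winner_pmf (\<lambda>r. game_prob (P r)) (game_server s n))) \<Otimes>\<^sub>M
     (\<Pi>\<^sub>M n\<in>UNIV. measure_pmf (winner_pmf P (tiebreak_server s n)))"

definition wins :: "(nat \<Rightarrow> player) \<Rightarrow> player \<Rightarrow> nat \<Rightarrow> nat" where
  "wins w p n = card {i. i < n \<and> w i = p}"

definition reached :: "nat \<Rightarrow> (nat \<Rightarrow> player) \<Rightarrow> player \<Rightarrow> nat \<Rightarrow> bool" where
  "reached m w p n \<longleftrightarrow> wins w p n \<ge> m \<and> wins w p n \<ge> wins w (opponent p) n + 2"

definition six_all :: "(nat \<Rightarrow> player) \<Rightarrow> nat \<Rightarrow> bool" where
  "six_all g n \<longleftrightarrow> wins g PlayerA n = 6 \<and> wins g PlayerB n = 6"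

text \<open>The number of games played before a possible tiebreak; it never exceeds 12.\<close>

definition regular_games :: "(nat \<Rightarrow> player) \<Rightarrow> nat" where
  "regular_games g = (LEAST n. (\<exists>p. reached 6 g p n) \<or> six_all g n)"

text \<open>The value is arbitrary on the null set of sequences for which the tiebreak never ends.\<close>

definition tiebreak_winner :: "(nat \<Rightarrow> player) \<Rightarrow> player" where
  "tiebreak_winner t = (THE p. reached 7 t p (LEAST n. \<exists>q. reached 7 t q n))"

definition final_score :: "(nat \<Rightarrow> player) \<Rightarrow> (nat \<Rightarrow> player) \<Rightarrow> player \<Rightarrow> nat" where
  "final_score g t p =
     wins g p (regular_games g) +
     (if six_all g (regular_games g) \<and> tiebreak_winner t = p then 1 else 0)"

definition total_games :: "(nat \<Rightarrow> player) \<Rightarrow> (nat \<Rightarrow> player) \<Rightarrow> nat" where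
  "total_games g t = final_score g t PlayerA + final_score g t PlayerB"

definition expected_set_games :: "(player \<Rightarrow> real) \<Rightarrow> player \<Rightarrow> real" where
  "expected_set_games P s = (\<integral>(g, t). real (total_games g t) \<partial>set_space P s)"

end

theory Submission
  imports Defs
begin

text \<open>
  Write \<open>a\<close> and \<open>b\<close> for the probabilities that \<open>A\<close> and \<open>B\<close> hold serve. Two observations reduce the
  theorem to a comparison of two binomial-like distributions.

  First, the length of a set is read off from the numbers of games won by \<open>A\<close> after 6, 7, 8, 9, 10
  and 12 games (\<open>total_games_eq\<close>), a tiebreak counting as one game whoever wins it. The two service orders differ only by exchanging the servers of games \<open>2k\<close> and
  \<open>2k + 1\<close>. Transporting the sequence of winners along this exchange turns the law for one order
  into the law for the other and leaves the score after every even number of games unchanged. So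
  everything cancels in the difference of the two expectations except the probabilities that the
  set goes on after 7 and after 9 games.

  Second, consider \<open>2m + 1\<close> games, \<open>m = 3, 4\<close>. The score after the first \<open>2m\<close> games has the same law
  for both orders, and the last game is won by \<open>A\<close> with probability \<open>a\<close> if \<open>A\<close> served first, and with
  probability \<open>1 - b\<close> otherwise. If \<open>Y\<close> is the number of games that \<open>A\<close> has won out of \<open>2m\<close>, a last
  game won by \<open>A\<close> rather than \<open>B\<close> keeps the set alive when \<open>Y = 2m - 5\<close> and ends it when \<open>Y = 5\<close>
  (\<open>both_at_most_prob_Suc\<close>). Hence the difference of the two probabilities is
  \<open>(a + b - 1) (Pr (Y = 2m - 5) - Pr (Y = 5))\<close>.

  The values \<open>2m - 5\<close> and \<open>5\<close> are symmetric about \<open>m\<close>. Counted in pairs of games, \<open>Y - m\<close> is a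
  random walk that steps up with probability \<open>u = a (1 - b)\<close> and down with probability
  \<open>v = b (1 - a)\<close>, and \<open>v < u\<close> because \<open>b < a\<close>. A path ending at \<open>- i\<close> has \<open>i\<close> more down-steps than
  up-steps, so exchanging up and down gives \<open>Pr (Y = m - i) u\<^sup>i = Pr (Y = m + i) v\<^sup>i\<close>
  (\<open>walk_reflection\<close>). Therefore \<open>Pr (Y = m - i) < Pr (Y = m + i)\<close> for \<open>0 < i \<le> m\<close>, and the difference
  above is negative.
\<close>

section \<open>The probability of holding serve\<close>

lemma game_prob_alt:
  fixes x :: real
  shows "game_prob x = x ^ 4 * ((15 - 4 * x) * (x\<^sup>2 + (1 - x)\<^sup>2) - 10 * x\<^sup>2) / (x\<^sup>2 + (1 - x)\<^sup>2)"
proof -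
  have d: "1 - 2 * x * (1 - x) = x\<^sup>2 + (1 - x)\<^sup>2"
    by (simp add: power2_eq_square algebra_simps)
  have "x\<^sup>2 + (1 - x)\<^sup>2 \<noteq> 0"
    by (simp add: sum_power2_eq_zero_iff)
  then show ?thesis
    unfolding game_prob_def d by (simp add: field_simps)
qed

text \<open>One of the two players wins the game, and exchanging their roles replaces \<open>x\<close> by \<open>1 - x\<close>. This
  makes the upper bound on \<open>game_prob\<close> a consequence of the lower one.\<close>

lemma game_prob_complement: "game_prob x + game_prob (1 - x) = 1"
proof -
  have "x\<^sup>2 + (1 - x)\<^sup>2 \<noteq> 0"
    by (simp add: sum_power2_eq_zero_iff)
  then show ?thesis
    unfolding game_prob_alt
    by (simp add: add_divide_distrib[symmetric] add.commute divide_eq_eq) algebra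
qed

lemma game_prob_pos:
  assumes "0 < x" "x < 1"
  shows "0 < game_prob x"
proof -
  let ?y = "1 - x"
  \<comment> \<open>With \<open>y = 1 - x\<close>, a win to 0, 15 or 30 has probability \<open>x\<^sup>4 (1 + 4y + 10y\<^sup>2)\<close>, and a win after
    deuce has probability \<open>20 x\<^sup>3 y\<^sup>3 x\<^sup>2 / (x\<^sup>2 + y\<^sup>2)\<close>; this is their sum, cleared of \<open>x\<^sup>4\<close> and of the
    denominator.\<close>
  have "(15 - 4 * x) * (x\<^sup>2 + ?y\<^sup>2) - 10 * x\<^sup>2
      = (1 + 4 * ?y + 10 * ?y\<^sup>2) * (x\<^sup>2 + ?y\<^sup>2) + 20 * x * ?y ^ 3"
    by algebra
  also have "\<dots> > 0"
    using assms by (intro add_pos_pos mult_pos_pos) (auto intro: add_pos_nonneg)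
  finally show ?thesis
    unfolding game_prob_alt using assms
    by (intro divide_pos_pos mult_pos_pos) (auto intro: add_pos_nonneg)
qed

lemma game_prob_less_1:
  assumes "0 < x" "x < 1"
  shows "game_prob x < 1"
  using game_prob_pos[of "1 - x"] game_prob_complement[of x] assms by simp

section \<open>The number of games as a function of the winners of the first twelve\<close>

lemma wins_0 [simp]: "wins g p 0 = 0"
  by (simp add: wins_def)

lemma wins_Suc: "wins g p (Suc n) = wins g p n + of_bool (g n = p)"
proof -
  have "{i. i < Suc n \<and> g i = p} = {i. i < n \<and> g i = p} \<union> (if g n = p then {n} else {})"
    by (auto simp: less_Suc_eq)
  then show ?thesis
    by (simp add: wins_def)
qed

lemma wins_PlayerB: "wins g PlayerB n = n - wins g PlayerA n"
  and wins_PlayerA_le: "wins g PlayerA n \<le> n"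
proof -
  have "wins g PlayerA n + wins g PlayerB n = n"
  proof (induction n)
    case (Suc n)
    then show ?case by (cases "g n") (auto simp: wins_Suc)
  qed simp
  then show "wins g PlayerB n = n - wins g PlayerA n" "wins g PlayerA n \<le> n"
    by simp_all
qed

text \<open>The second conjunct bounds the wins of \<open>B\<close>, see \<open>wins_PlayerB\<close>. With \<open>m = 5\<close> and \<open>n \<le> 10\<close> it says that the set is still going on, and with
  \<open>n = 2m\<close> that the score is level at \<open>m\<close>.\<close>

definition both_at_most :: "nat \<Rightarrow> nat \<Rightarrow> (nat \<Rightarrow> player) \<Rightarrow> bool" where
  "both_at_most m n g \<longleftrightarrow> wins g PlayerA n \<le> m \<and> n - wins g PlayerA n \<le> m"

text \<open>The six games that are always played, plus one game for each \<open>n \<ge> 6\<close> such that the set goes on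
  after \<open>n\<close> games. At \<open>5-5\<close> two further games are certain, hence the factor 2, and the tiebreak needs
  \<open>5-5\<close> after ten games and \<open>6-6\<close> after twelve. The terms with an even number of games are
  grouped together, because only they are invariant under the exchange of servers.\<close>

definition set_length :: "(nat \<Rightarrow> player) \<Rightarrow> nat" where
  "set_length g = 6 + (of_bool (both_at_most 5 6 g) + of_bool (both_at_most 5 8 g)
     + 2 * of_bool (both_at_most 5 10 g) + of_bool (both_at_most 5 10 g \<and> both_at_most 6 12 g))
     + (of_bool (both_at_most 5 7 g) + of_bool (both_at_most 5 9 g))"

lemma both_at_most_antimono:
  assumes "both_at_most m n g" "k \<le> n"
  shows "both_at_most m k g"
proof -
  have down: "both_at_most m i g" if "both_at_most m (Suc i) g" for i
    using that wins_PlayerA_le[of g i] by (auto simp: both_at_most_def wins_Suc of_bool_def split: if_splits)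
  show ?thesis
    using assms(2) by (rule inc_induct) (use assms(1) down in auto)
qed

text \<open>Within ten games, a player who has six wins leads by at least two.\<close>

lemma set_over_iff_not_both_at_most:
  assumes "n \<le> 10"
  shows "(\<exists>p. reached 6 g p n) \<or> six_all g n \<longleftrightarrow> \<not> both_at_most 5 n g"
proof -
  have "(\<exists>p. reached 6 g p n) \<longleftrightarrow> reached 6 g PlayerA n \<or> reached 6 g PlayerB n"
    by (metis player.exhaust)
  then show ?thesis
    using assms wins_PlayerA_le[of g n]
    by (auto simp: reached_def six_all_def wins_PlayerB both_at_most_def)
qed

text \<open>The tiebreak winner is some player, even on the sequences for which the tiebreak never ends. So
  the tiebreak adds exactly one game, and the equation holds pointwise.\<close>

lemma total_games_regular:
  "total_games g t = regular_games g + of_bool (six_all g (regular_games g))"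
proof -
  have "tiebreak_winner t = PlayerA \<or> tiebreak_winner t = PlayerB"
    by (metis player.exhaust)
  then show ?thesis
    using wins_PlayerA_le[of g "regular_games g"]
    by (auto simp: total_games_def final_score_def wins_PlayerB)
qed

lemma regular_games_eqI:
  assumes "(\<exists>p. reached 6 g p m) \<or> six_all g m"
    and "\<And>k. k < m \<Longrightarrow> \<not> ((\<exists>p. reached 6 g p k) \<or> six_all g k)"
  shows "regular_games g = m"
  unfolding regular_games_def using assms
  by (intro Least_equality) (auto simp: not_less[symmetric])

text \<open>If the set is not at \<open>5-5\<close> after ten games, its length is the first \<open>n\<close> at which a player has six
  wins, so \<open>both_at_most 5 k\<close> is the same as \<open>k < n\<close>. Otherwise eleven games never suffice and twelve
  end the regular part.\<close>

lemma total_games_eq: "total_games g t = set_length g"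
proof (cases "both_at_most 5 10 g")
  case False
  define m where "m = (LEAST n. \<not> both_at_most 5 n g)"
  have m: "\<not> both_at_most 5 m g" "m \<le> 10"
    unfolding m_def using False by (rule LeastI, rule Least_le)
  have lev: "both_at_most 5 k g \<longleftrightarrow> k < m" for k
    using m(1) both_at_most_antimono[of 5 k g m] not_less_Least[of k "\<lambda>n. \<not> both_at_most 5 n g"]
    by (auto simp: m_def[symmetric] not_less intro: leI)
  have "both_at_most 5 5 g"
    using wins_PlayerA_le[of g 5] by (simp add: both_at_most_def)
  then have "5 < m"
    by (simp add: lev)
  have N: "regular_games g = m"
    using m lev by (intro regular_games_eqI) (auto simp: set_over_iff_not_both_at_most)
  have "\<not> six_all g m"
    using m(2) wins_PlayerA_le[of g m] by (auto simp: six_all_def wins_PlayerB)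
  then have T: "total_games g t = m"
    by (simp add: total_games_regular N)
  have "m = 6 \<or> m = 7 \<or> m = 8 \<or> m = 9 \<or> m = 10"
    using \<open>5 < m\<close> m(2) by presburger
  then show ?thesis
    unfolding T set_length_def lev by (elim disjE) simp_all
next
  case True
  have lev: "both_at_most 5 k g" if "k \<le> 10" for k
    using True that by (rule both_at_most_antimono)
  have y10: "wins g PlayerA 10 = 5"
    using True by (auto simp: both_at_most_def)
  have y11: "wins g PlayerA 11 = 5 \<or> wins g PlayerA 11 = 6"
    using wins_Suc[of g PlayerA 10] y10 by simp
  have y12: "wins g PlayerA 12 = wins g PlayerA 11 \<or> wins g PlayerA 12 = Suc (wins g PlayerA 11)"
    using wins_Suc[of g PlayerA 11] by simp
  have over: "(\<exists>p. reached 6 g p n) \<longleftrightarrow> reached 6 g PlayerA n \<or> reached 6 g PlayerB n" for n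
    by (metis player.exhaust)
  have N: "regular_games g = 12"
  proof (rule regular_games_eqI)
    show "(\<exists>p. reached 6 g p 12) \<or> six_all g 12"
      using y11 y12 unfolding over by (auto simp: reached_def six_all_def wins_PlayerB)
  next
    fix k :: nat assume "k < 12"
    then consider "k \<le> 10" | "k = 11"
      by linarith
    then show "\<not> ((\<exists>p. reached 6 g p k) \<or> six_all g k)"
    proof cases
      case 1
      then show ?thesis by (simp add: set_over_iff_not_both_at_most lev)
    next
      case 2
      show ?thesis
        using y11 unfolding 2 over by (auto simp: reached_def six_all_def wins_PlayerB)
    qed
  qed
  have "six_all g 12 \<longleftrightarrow> both_at_most 6 12 g"
    by (auto simp: six_all_def wins_PlayerB both_at_most_def)
  then show ?thesis
    by (simp add: total_games_regular N set_length_def lev)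
qed

section \<open>Sequences of independent winners\<close>

text \<open>The winners of independent games whose individual laws \<open>D n\<close> may be arbitrary, so that exchanging
  servers is a mere reindexing of \<open>D\<close>.\<close>

definition word_space :: "(nat \<Rightarrow> player pmf) \<Rightarrow> (nat \<Rightarrow> player) measure" where
  "word_space D = (\<Pi>\<^sub>M n\<in>UNIV. measure_pmf (D n))"

text \<open>The law of the number of games won by \<open>A\<close>. The argument \<open>k\<close> is an integer so that the recursion
  over \<open>n\<close> and reflections about \<open>n / 2\<close> need no care at the boundary: impossible values have
  probability 0.\<close>

definition count_prob :: "(nat \<Rightarrow> player pmf) \<Rightarrow> nat \<Rightarrow> int \<Rightarrow> real" where
  "count_prob D n k = measure (word_space D) {g. int (wins g PlayerA n) = k}"

lemma prob_space_word_space: "prob_space (word_space D)"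
  unfolding word_space_def by (intro prob_space_PiM measure_pmf.prob_space_axioms)

lemma space_word_space [simp]: "space (word_space D) = UNIV"
  by (simp add: word_space_def space_PiM)

lemma measurable_coordinate [measurable]: "(\<lambda>g. g n) \<in> word_space D \<rightarrow>\<^sub>M count_space UNIV"
proof -
  have "(\<lambda>g. g n) \<in> word_space D \<rightarrow>\<^sub>M measure_pmf (D n)"
    unfolding word_space_def by (rule measurable_component_singleton) simp
  then show ?thesis by simp
qed

lemma measurable_wins [measurable]: "(\<lambda>g. wins g p n) \<in> word_space D \<rightarrow>\<^sub>M count_space UNIV"
proof (induction n)
  case (Suc n)
  note [measurable] = Suc
  show ?case unfolding wins_Suc by measurable
qed simp

lemma measurable_both_at_most [measurable]: "Measurable.pred (word_space D) (both_at_most m n)"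
  unfolding both_at_most_def by measurable

lemma measurable_set_length [measurable]:
  "(\<lambda>g. real (set_length g)) \<in> borel_measurable (word_space D)"
  unfolding set_length_def by measurable

lemma wins_event [measurable]: "{g. int (wins g p n) = k} \<in> sets (word_space D)"
proof -
  have "{g \<in> space (word_space D). int (wins g p n) = k} \<in> sets (word_space D)"
    by measurable
  then show ?thesis by simp
qed

lemma winner_event [measurable]: "{g. g n = p} \<in> sets (word_space D)"
proof -
  have "{g \<in> space (word_space D). g n = p} \<in> sets (word_space D)"
    by measurable
  then show ?thesis by simp
qed

lemma wins_cong:
  assumes "\<And>i. i < n \<Longrightarrow> g i = h i"
  shows "wins g p n = wins h p n"
  unfolding wins_def using assms by (auto intro!: arg_cong[where f = card])

lemma coordinates_indep:
  "prob_space.indep_vars (word_space D) (\<lambda>n. measure_pmf (D n)) (\<lambda>n g. g n) UNIV"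
proof -
  interpret prob_space "word_space D" by (rule prob_space_word_space)
  have "distr (word_space D) (measure_pmf (D i)) (\<lambda>g. g i) = measure_pmf (D i)" for i
    unfolding word_space_def
    by (rule distr_PiM_component) (auto intro: measure_pmf.prob_space_axioms)
  moreover have "(\<lambda>x. restrict x UNIV) = (\<lambda>x::nat \<Rightarrow> player. x)"
    by (simp add: restrict_def)
  ultimately show ?thesis
    by (subst indep_vars_iff_distr_eq_PiM')
       (simp_all add: word_space_def[symmetric])
qed

lemma winner_prob: "measure (word_space D) {g. g n = p} = pmf (D n) p"
proof -
  have *: "(\<lambda>g. g n) \<in> word_space D \<rightarrow>\<^sub>M measure_pmf (D n)"
    by simp
  have "distr (word_space D) (measure_pmf (D n)) (\<lambda>g. g n) = measure_pmf (D n)"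
    unfolding word_space_def
    by (rule distr_PiM_component) (auto intro: measure_pmf.prob_space_axioms)
  then have "pmf (D n) p = measure (distr (word_space D) (measure_pmf (D n)) (\<lambda>g. g n)) {p}"
    by (simp add: measure_pmf_single)
  also have "\<dots> = measure (word_space D) {g. g n = p}"
    by (subst measure_distr) (auto simp: vimage_def *)
  finally show ?thesis by simp
qed

text \<open>The number of wins depends on the coordinates below \<open>n\<close> only, and the event on the right on
  coordinate \<open>n\<close> only.\<close>

lemma wins_indep_next:
  "measure (word_space D) ({g. int (wins g PlayerA n) = k} \<inter> {g. g n = p})
    = count_prob D n k * pmf (D n) p"
proof -
  interpret prob_space "word_space D" by (rule prob_space_word_space)
  let ?M = "\<lambda>i. measure_pmf (D i)"
  have "indep_var (PiM {..<n} ?M) (\<lambda>g. restrict (\<lambda>i. g i) {..<n})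
                  (PiM {n} ?M) (\<lambda>g. restrict (\<lambda>i. g i) {n})"
    by (rule indep_var_restrict[OF coordinates_indep]) auto
  then have I: "indep_var
      (count_space UNIV) ((\<lambda>h. int (wins h PlayerA n) = k) \<circ> (\<lambda>g. restrict (\<lambda>i. g i) {..<n}))
      (count_space UNIV) ((\<lambda>h. h n = p) \<circ> (\<lambda>g. restrict (\<lambda>i. g i) {n}))"
  proof (rule indep_var_compose)
    have "(\<lambda>h. wins h PlayerA m) \<in> PiM {..<n} ?M \<rightarrow>\<^sub>M count_space UNIV" if "m \<le> n" for m
      using that
    proof (induction m)
      case (Suc m)
      have [measurable]: "(\<lambda>h. h m) \<in> PiM {..<n} ?M \<rightarrow>\<^sub>M count_space UNIV"
        using Suc.prems measurable_component_singleton[of m "{..<n}" ?M] by simp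
      have [measurable]: "(\<lambda>h. wins h PlayerA m) \<in> PiM {..<n} ?M \<rightarrow>\<^sub>M count_space UNIV"
        using Suc by simp
      show ?case unfolding wins_Suc by measurable
    qed simp
    from this[of n] have [measurable]: "(\<lambda>h. wins h PlayerA n) \<in> PiM {..<n} ?M \<rightarrow>\<^sub>M count_space UNIV"
      by simp
    show "(\<lambda>h. int (wins h PlayerA n) = k) \<in> PiM {..<n} ?M \<rightarrow>\<^sub>M count_space UNIV"
      by measurable
    have [measurable]: "(\<lambda>h. h n) \<in> PiM {n} ?M \<rightarrow>\<^sub>M count_space UNIV"
      using measurable_component_singleton[of n "{n}" ?M] by simp
    show "(\<lambda>h. h n = p) \<in> PiM {n} ?M \<rightarrow>\<^sub>M count_space UNIV"
      by measurable
  qed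
  have "wins (restrict g {..<n}) PlayerA n = wins g PlayerA n" for g
    by (rule wins_cong) simp
  then have "indep_var (count_space UNIV) (\<lambda>g. int (wins g PlayerA n) = k) (count_space UNIV) (\<lambda>g. g n = p)"
    using I by (simp add: o_def)
  from indep_varD[OF this, of "{True}" "{True}"] show ?thesis
    by (simp add: count_prob_def winner_prob vimage_def Int_def)
qed

lemma count_prob_Suc:
  "count_prob D (Suc n) k
    = pmf (D n) PlayerA * count_prob D n (k - 1) + (1 - pmf (D n) PlayerA) * count_prob D n k"
proof -
  interpret prob_space "word_space D" by (rule prob_space_word_space)
  let ?E = "\<lambda>k. {g. int (wins g PlayerA n) = k}" and ?W = "\<lambda>p. {g. g n = p}"
  have AB: "g n = PlayerB \<longleftrightarrow> g n \<noteq> PlayerA" for g :: "nat \<Rightarrow> player"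
    by (cases "g n") auto
  have B: "pmf (D n) PlayerB = 1 - pmf (D n) PlayerA"
  proof -
    have "?W PlayerB = space (word_space D) - ?W PlayerA"
      using AB by auto
    then have "prob (?W PlayerB) = 1 - prob (?W PlayerA)"
      by (simp only:) (rule prob_compl, measurable)
    then show ?thesis by (simp add: winner_prob)
  qed
  have "{g. int (wins g PlayerA (Suc n)) = k} = (?E (k - 1) \<inter> ?W PlayerA) \<union> (?E k \<inter> ?W PlayerB)"
  proof (rule set_eqI)
    fix g
    show "g \<in> {g. int (wins g PlayerA (Suc n)) = k}
      \<longleftrightarrow> g \<in> (?E (k - 1) \<inter> ?W PlayerA) \<union> (?E k \<inter> ?W PlayerB)"
      by (cases "g n") (auto simp: wins_Suc)
  qed
  moreover have "(?E (k - 1) \<inter> ?W PlayerA) \<inter> (?E k \<inter> ?W PlayerB) = {}"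
    by auto
  ultimately have "count_prob D (Suc n) k
      = prob (?E (k - 1) \<inter> ?W PlayerA) + prob (?E k \<inter> ?W PlayerB)"
    unfolding count_prob_def[of D "Suc n"]
    by (simp only:) (rule finite_measure_Union, (rule sets.Int wins_event winner_event)+)
  then show ?thesis
    by (simp add: wins_indep_next B mult.commute)
qed

lemma count_prob_0: "count_prob D 0 k = of_bool (k = 0)"
proof -
  interpret prob_space "word_space D" by (rule prob_space_word_space)
  show ?thesis
    using prob_space by (auto simp: count_prob_def)
qed

lemma both_at_most_prob:
  assumes "n \<le> 2 * m"
  shows "measure (word_space D) {g. both_at_most m n g} = (\<Sum>k = int n - int m..int m. count_prob D n k)"
proof -
  interpret prob_space "word_space D" by (rule prob_space_word_space)
  have "{g. both_at_most m n g} = (\<Union>k\<in>{int n - int m..int m}. {g. int (wins g PlayerA n) = k})"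
  proof (intro set_eqI iffI)
    fix g assume "g \<in> {g. both_at_most m n g}"
    then show "g \<in> (\<Union>k\<in>{int n - int m..int m}. {g. int (wins g PlayerA n) = k})"
      using wins_PlayerA_le[of g n] by (auto simp: both_at_most_def)
  next
    fix g assume "g \<in> (\<Union>k\<in>{int n - int m..int m}. {g. int (wins g PlayerA n) = k})"
    then show "g \<in> {g. both_at_most m n g}"
      by (auto simp: both_at_most_def)
  qed
  moreover have "prob (\<Union>k\<in>{int n - int m..int m}. {g. int (wins g PlayerA n) = k})
      = (\<Sum>k\<in>{int n - int m..int m}. prob {g. int (wins g PlayerA n) = k})"
    by (rule finite_measure_finite_Union) (auto simp: disjoint_family_on_def)
  ultimately show ?thesis
    by (simp add: count_prob_def)
qed

text \<open>Given \<open>k\<close> wins of \<open>A\<close> in \<open>n\<close> games, the winner of the next game matters in two cases only: at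
  \<open>k = n - m\<close>, where \<open>B\<close> has \<open>m\<close> wins and the next game must go to \<open>A\<close>, and at \<open>k = m\<close>, where it must not.
  Formally, the recursion for \<open>count_prob\<close> is summed and the shifted sum telescopes.\<close>

lemma both_at_most_prob_Suc:
  assumes "n < 2 * m"
  shows "measure (word_space D) {g. both_at_most m (Suc n) g}
    = (\<Sum>k = int n + 1 - int m..int m. count_prob D n k)
      + pmf (D n) PlayerA * (count_prob D n (int n - int m) - count_prob D n (int m))"
proof -
  let ?c = "count_prob D n" and ?p = "pmf (D n) PlayerA" and ?l = "int n + 1 - int m"
  have le: "?l \<le> int m" using assms by simp
  have shift: "(\<Sum>k = ?l..int m. ?c (k - 1)) = (\<Sum>k = ?l - 1..int m - 1. ?c k)"
    by (rule sum.reindex_bij_witness[of _ "\<lambda>k. k + 1" "\<lambda>k. k - 1"]) auto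
  have lower: "{?l - 1..int m - 1} = insert (?l - 1) {?l..int m - 1}"
    and upper: "{?l..int m} = insert (int m) {?l..int m - 1}"
    using le by auto
  have "(\<Sum>k = ?l..int m. ?c (k - 1)) - (\<Sum>k = ?l..int m. ?c k) = ?c (int n - int m) - ?c (int m)"
    unfolding shift unfolding lower upper by simp
  moreover have "measure (word_space D) {g. both_at_most m (Suc n) g}
      = (\<Sum>k = ?l..int m. ?p * ?c (k - 1) + (1 - ?p) * ?c k)"
    using assms by (subst both_at_most_prob) (simp_all add: count_prob_Suc add.commute)
  ultimately show ?thesis
    by (simp add: sum.distrib sum_distrib_left[symmetric]) algebra
qed

section \<open>Exchanging the servers within pairs of consecutive games\<close>

definition swap_pair :: "nat \<Rightarrow> nat" where
  "swap_pair n = (if even n then Suc n else n - 1)"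

lemma swap_pair_swap_pair [simp]: "swap_pair (swap_pair n) = n"
  by (auto simp: swap_pair_def)

text \<open>Permuting the coordinates of a product measure permutes its factors.\<close>

lemma word_space_swap:
  "distr (word_space D) (word_space (\<lambda>n. D (swap_pair n))) (\<lambda>g n. g (swap_pair n))
    = word_space (\<lambda>n. D (swap_pair n))"
proof -
  have "inj swap_pair"
    by (metis injI swap_pair_swap_pair)
  then show ?thesis
    unfolding word_space_def
    using distr_PiM_reindex[of UNIV "\<lambda>n. measure_pmf (D n)" swap_pair UNIV]
    by (simp add: measure_pmf.prob_space_axioms restrict_def)
qed

text \<open>The exchange permutes the games within each completed pair.\<close>

lemma wins_swap: "wins (\<lambda>n. g (swap_pair n)) p (2 * m) = wins g p (2 * m)"
  by (induction m) (simp_all add: wins_Suc swap_pair_def)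

lemma both_at_most_swap: "even n \<Longrightarrow> both_at_most m n (\<lambda>n. g (swap_pair n)) = both_at_most m n g"
  by (auto simp: both_at_most_def wins_swap elim!: evenE)

lemma measurable_swap [measurable]:
  "(\<lambda>g n. g (swap_pair n)) \<in> word_space D \<rightarrow>\<^sub>M word_space (\<lambda>n. D (swap_pair n))"
proof -
  have "(\<lambda>g. g (swap_pair n)) \<in> word_space D \<rightarrow>\<^sub>M measure_pmf (D (swap_pair n))" for n
    by simp
  then show ?thesis
    unfolding word_space_def by (intro measurable_PiM_single') auto
qed

lemma expectation_swap:
  fixes f :: "(nat \<Rightarrow> player) \<Rightarrow> real"
  assumes "f \<in> borel_measurable (word_space (\<lambda>n. D (swap_pair n)))"
    and "\<And>g. f (\<lambda>n. g (swap_pair n)) = f g"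
  shows "integral\<^sup>L (word_space (\<lambda>n. D (swap_pair n))) f = integral\<^sup>L (word_space D) f"
proof -
  have "integral\<^sup>L (word_space (\<lambda>n. D (swap_pair n))) f
      = integral\<^sup>L (word_space D) (\<lambda>g. f (\<lambda>n. g (swap_pair n)))"
    using assms(1) by (subst word_space_swap[symmetric]) (rule integral_distr, measurable)
  then show ?thesis by (simp add: assms(2))
qed

lemma count_prob_swap:
  "count_prob (\<lambda>n. D (swap_pair n)) (2 * m) k = count_prob D (2 * m) k"
proof -
  let ?S = "{g. int (wins g PlayerA (2 * m)) = k}"
  have "integral\<^sup>L (word_space (\<lambda>n. D (swap_pair n))) (indicator ?S :: _ \<Rightarrow> real)
      = integral\<^sup>L (word_space D) (indicator ?S)"
    by (rule expectation_swap) (auto simp: indicator_def wins_swap)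
  then show ?thesis
    by (simp add: count_prob_def)
qed

section \<open>The stronger server is more likely to lead after equally many service games\<close>

text \<open>Here \<open>f m\<close> is the law after \<open>m\<close> steps of a walk with up, stay and down probabilities \<open>u\<close>, \<open>w\<close>, \<open>v\<close>.
  Exchanging the up- and down-steps is a bijection from the paths ending at \<open>- i\<close> to those ending at
  \<open>i\<close>, and multiplies the weight of each path by \<open>(u / v)\<^sup>i\<close>. The induction over \<open>m\<close> uses the recursion
  in place of the paths, and the statement avoids division.\<close>

lemma walk_reflection:
  fixes f :: "nat \<Rightarrow> int \<Rightarrow> real"
  assumes f0: "\<And>j. f 0 j = of_bool (j = 0)"
    and fSuc: "\<And>m j. f (Suc m) j = u * f m (j - 1) + w * f m j + v * f m (j + 1)"
  shows "f m (- int i) * u ^ i = f m (int i) * v ^ i"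
proof (induction m arbitrary: i)
  case 0
  show ?case by (cases i) (simp_all add: f0)
next
  case (Suc m)
  show ?case
  proof (cases i)
    case (Suc j)
    have 1: "f m (- int (Suc (Suc j))) * u ^ Suc (Suc j) = f m (int (Suc (Suc j))) * v ^ Suc (Suc j)"
      and 2: "f m (- int (Suc j)) * u ^ Suc j = f m (int (Suc j)) * v ^ Suc j"
      and 3: "f m (- int j) * u ^ j = f m (int j) * v ^ j"
      by (rule Suc.IH)+
    have e: "- int (Suc j) - 1 = - int (Suc (Suc j))" "- int (Suc j) + 1 = - int j"
      "int (Suc j) - 1 = int j" "int (Suc j) + 1 = int (Suc (Suc j))"
      by simp_all
    have "f (Suc m) (- int (Suc j)) * u ^ Suc j
        = f m (- int (Suc (Suc j))) * u ^ Suc (Suc j) + w * (f m (- int (Suc j)) * u ^ Suc j)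
          + u * v * (f m (- int j) * u ^ j)"
      unfolding fSuc e by (simp only: power_Suc) algebra
    also have "\<dots> = f (Suc m) (int (Suc j)) * v ^ Suc j"
      unfolding 1 2 3 unfolding fSuc e by (simp only: power_Suc) algebra
    finally show ?thesis using Suc by simp
  qed simp
qed

text \<open>The end point \<open>i\<close> is reached by \<open>i\<close> up-steps and \<open>m - i\<close> stays. Positivity is what turns the
  reflection identity into a strict inequality.\<close>

lemma walk_pos:
  fixes f :: "nat \<Rightarrow> int \<Rightarrow> real"
  assumes f0: "\<And>j. f 0 j = of_bool (j = 0)"
    and fSuc: "\<And>m j. f (Suc m) j = u * f m (j - 1) + w * f m j + v * f m (j + 1)"
    and pos: "u > 0" "w > 0" "v > 0"
  shows "i \<le> m \<Longrightarrow> 0 < f m (int i)"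
proof -
  have nonneg: "0 \<le> f m j" for m j
    using pos by (induction m arbitrary: j) (auto simp: f0 fSuc)
  show "i \<le> m \<Longrightarrow> 0 < f m (int i)"
  proof (induction m arbitrary: i)
    case (Suc m)
    show ?case
    proof (cases i)
      case 0
      then have "0 < f m (int i)" by (simp only: Suc.IH)
      then show ?thesis
        unfolding fSuc using pos nonneg by (intro add_pos_nonneg add_nonneg_pos mult_pos_pos) auto
    next
      case (Suc j)
      then have "0 < f m (int i - 1)" using Suc.IH[of j] Suc.prems by simp
      then show ?thesis
        unfolding fSuc using pos nonneg by (intro add_pos_nonneg mult_pos_pos) auto
    qed
  qed (simp add: f0)
qed

lemma walk_drift:
  fixes f :: "nat \<Rightarrow> int \<Rightarrow> real"
  assumes f0: "\<And>j. f 0 j = of_bool (j = 0)"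
    and fSuc: "\<And>m j. f (Suc m) j = u * f m (j - 1) + w * f m j + v * f m (j + 1)"
    and pos: "w > 0" "v > 0" and drift: "v < u"
    and i: "0 < i" "i \<le> m"
  shows "f m (- int i) < f m (int i)"
proof -
  have f: "0 < f m (int i)"
    using walk_pos[of f u w v, OF f0 fSuc] pos drift i by simp
  have "v ^ i < u ^ i"
    using pos drift i by (intro power_strict_mono) auto
  then have "f m (int i) * v ^ i < f m (int i) * u ^ i"
    using f by simp
  then have "f m (- int i) * u ^ i < f m (int i) * u ^ i"
    by (simp add: walk_reflection[of f u w v, OF f0 fSuc])
  then show ?thesis
    using pos drift by (simp add: mult_less_cancel_right)
qed

definition game_word :: "(player \<Rightarrow> real) \<Rightarrow> player \<Rightarrow> nat \<Rightarrow> player pmf" where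
  "game_word q s n = winner_pmf q (game_server s n)"

lemma pmf_winner:
  assumes "0 \<le> q s" "q s \<le> 1"
  shows "pmf (winner_pmf q s) PlayerA = (if s = PlayerA then q s else 1 - q s)"
proof -
  have "pmf (winner_pmf q s) (if b then s else opponent s) = pmf (bernoulli_pmf (q s)) b" for b
    unfolding winner_pmf_def
    by (rule pmf_map_inj') (cases s; auto simp: inj_def)
  from this[of "s = PlayerA"] assms show ?thesis
    by (cases s) auto
qed

lemma game_word_swap: "(\<lambda>n. game_word q PlayerA (swap_pair n)) = game_word q PlayerB"
  by (auto simp: game_word_def game_server_def swap_pair_def)

text \<open>A pair of games, one on each serve, gives \<open>A\<close> two wins with probability \<open>u = a (1 - b)\<close>, none with
  probability \<open>v = b (1 - a)\<close>, and otherwise one. So the number of wins of \<open>A\<close> in excess of the number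
  of pairs is a walk as above, and \<open>u - v = a - b\<close>.\<close>

lemma count_prob_lead:
  assumes q: "0 < q PlayerA" "q PlayerA < 1" "0 < q PlayerB" "q PlayerB < 1"
    and "q PlayerB < q PlayerA" and i: "0 < i" "i \<le> m"
  shows "count_prob (game_word q PlayerA) (2 * m) (int m - int i)
    < count_prob (game_word q PlayerA) (2 * m) (int m + int i)"
proof -
  define f where "f m j = count_prob (game_word q PlayerA) (2 * m) (int m + j)" for m j
  let ?a = "q PlayerA" and ?b = "q PlayerB"
  let ?u = "?a * (1 - ?b)" and ?v = "?b * (1 - ?a)" and ?w = "?a * ?b + (1 - ?a) * (1 - ?b)"
  have "f 0 j = of_bool (j = 0)" for j
    by (simp add: f_def count_prob_0)
  moreover have "f (Suc m) j = ?u * f m (j - 1) + ?w * f m j + ?v * f m (j + 1)" for m j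
  proof -
    have e: "2 * Suc m = Suc (Suc (2 * m))" by simp
    have k: "int (Suc m) + j = int m + (j + 1)" "int m + (j + 1) - 1 = int m + j"
      "int m + j - 1 = int m + (j - 1)" by simp_all
    have p: "pmf (game_word q PlayerA (Suc (2 * m))) PlayerA = 1 - ?b"
      "pmf (game_word q PlayerA (2 * m)) PlayerA = ?a"
      using q by (simp_all add: game_word_def game_server_def pmf_winner)
    show ?thesis
      unfolding f_def e count_prob_Suc k p by (simp add: algebra_simps)
  qed
  moreover have "0 < ?w" "0 < ?v"
    using q by (simp_all add: add_pos_pos)
  moreover have "?v < ?u"
    using assms by (simp add: algebra_simps)
  ultimately have "f m (- int i) < f m (int i)"
    using i by (intro walk_drift[of f ?u ?w ?v])
  then show ?thesis
    by (simp add: f_def)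
qed

section \<open>Comparing the expected lengths\<close>

text \<open>The score of the first \<open>2m\<close> games has the same law for both orders, and at this score \<open>2m - k\<close> is
  less likely than its mirror image \<open>k\<close>. Since \<open>a > 1 - b\<close>, an extra game served by \<open>A\<close> instead of \<open>B\<close>
  shifts weight from the less likely to the more likely case in which it ends the set.\<close>

lemma both_at_most_prob_less:
  assumes q: "0 < q PlayerA" "q PlayerA < 1" "0 < q PlayerB" "q PlayerB < 1"
    and ab: "q PlayerA + q PlayerB > 1" "q PlayerB < q PlayerA"
    and m: "m < k" "k \<le> 2 * m"
  shows "measure (word_space (game_word q PlayerA)) {g. both_at_most k (Suc (2 * m)) g}
    < measure (word_space (game_word q PlayerB)) {g. both_at_most k (Suc (2 * m)) g}"
proof -
  let ?a = "q PlayerA" and ?b = "q PlayerB"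
  let ?c = "count_prob (game_word q PlayerA) (2 * m)"
  have cB: "count_prob (game_word q PlayerB) (2 * m) = ?c"
    using count_prob_swap[of "game_word q PlayerA" m] by (auto simp: game_word_swap)
  have "?c (int (2 * m) - int k) < ?c (int k)"
    using count_prob_lead[OF q ab(2), of "k - m" m] m by (simp add: of_nat_diff)
  then have "?a * (?c (int (2 * m) - int k) - ?c (int k))
      < (1 - ?b) * (?c (int (2 * m) - int k) - ?c (int k))"
    using ab by (intro mult_strict_right_mono_neg) auto
  moreover have "pmf (game_word q PlayerA (2 * m)) PlayerA = ?a"
      "pmf (game_word q PlayerB (2 * m)) PlayerA = 1 - ?b"
    using q by (simp_all add: game_word_def game_server_def pmf_winner)
  moreover have "2 * m < 2 * k" using m by simp
  ultimately show ?thesis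
    by (simp add: both_at_most_prob_Suc cB)
qed

lemma expected_set_games_eq:
  "expected_set_games P s
    = (\<integral>g. real (set_length g) \<partial>word_space (game_word (\<lambda>r. game_prob (P r)) s))"
proof -
  let ?G = "word_space (game_word (\<lambda>r. game_prob (P r)) s)"
  let ?T = "\<Pi>\<^sub>M n\<in>UNIV. measure_pmf (winner_pmf P (tiebreak_server s n))"
  interpret T: prob_space ?T by (intro prob_space_PiM measure_pmf.prob_space_axioms)
  have length: "(\<lambda>(g, t). real (total_games g t)) = (\<lambda>x. real (set_length (fst x)))"
    by (auto simp: fun_eq_iff total_games_eq)
  have "expected_set_games P s = (\<integral>x. real (set_length (fst x)) \<partial>(?G \<Otimes>\<^sub>M ?T))"
    unfolding expected_set_games_def set_space_def word_space_def game_word_def length ..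
  also have "\<dots> = (\<integral>g. real (set_length g) \<partial>distr (?G \<Otimes>\<^sub>M ?T) ?G fst)"
    by (rule integral_distr[symmetric]) measurable
  also have "distr (?G \<Otimes>\<^sub>M ?T) ?G fst = ?G"
    by (rule T.distr_pair_fst)
  finally show ?thesis .
qed

theorem proposition2p1:
  fixes P :: "player \<Rightarrow> real"
  assumes "0 < P PlayerA" and "P PlayerA < 1"
    and "0 < P PlayerB" and "P PlayerB < 1"
    and "game_prob (P PlayerA) + game_prob (P PlayerB) > 1"
    and "game_prob (P PlayerA) > game_prob (P PlayerB)"
  shows "expected_set_games P PlayerA < expected_set_games P PlayerB"
proof -
  define q where "q r = game_prob (P r)" for r
  have q: "0 < q PlayerA" "q PlayerA < 1" "0 < q PlayerB" "q PlayerB < 1"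
    using assms by (auto simp: q_def game_prob_pos game_prob_less_1)
  have ab: "q PlayerA + q PlayerB > 1" "q PlayerB < q PlayerA"
    using assms by (auto simp: q_def)
  let ?M = "\<lambda>s. word_space (game_word q s)"
  \<comment> \<open>the part of the length that depends only on scores after even numbers of games\<close>
  define E :: "(nat \<Rightarrow> player) \<Rightarrow> real" where
    "E g = of_bool (both_at_most 5 6 g) + of_bool (both_at_most 5 8 g)
       + 2 * of_bool (both_at_most 5 10 g) + of_bool (both_at_most 5 10 g \<and> both_at_most 6 12 g)" for g
  define L where "L k g = (of_bool (both_at_most 5 k g) :: real)" for k g
  have E_meas: "E \<in> borel_measurable (word_space D)" for D
    unfolding E_def by measurable
  have E_swap: "E (\<lambda>n. g (swap_pair n)) = E g" for g
    unfolding E_def by (simp add: both_at_most_swap)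
  have E_eq: "integral\<^sup>L (?M PlayerB) E = integral\<^sup>L (?M PlayerA) E"
    using expectation_swap[OF E_meas E_swap, of "game_word q PlayerA"] by (simp add: game_word_swap)
  have split: "expected_set_games P s
      = 6 + integral\<^sup>L (?M s) E + measure (?M s) {g. both_at_most 5 7 g} + measure (?M s) {g. both_at_most 5 9 g}"
    for s
  proof -
    interpret prob_space "?M s" by (rule prob_space_word_space)
    have iE: "integrable (?M s) E"
      by (rule integrable_const_bound[where B = 5]) (auto simp: E_def E_meas)
    have iL: "integrable (?M s) (L k)" for k
      unfolding L_def by (rule integrable_const_bound[where B = 1]) (simp, measurable)
    have L: "integral\<^sup>L (?M s) (L k) = prob {g. both_at_most 5 k g}" for k
    proof -
      have "L k = indicator {g. both_at_most 5 k g}"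
        by (auto simp: L_def indicator_def)
      then show ?thesis by simp
    qed
    have "expected_set_games P s = integral\<^sup>L (?M s) (\<lambda>g. real (set_length g))"
      unfolding expected_set_games_eq q_def[abs_def] ..
    also have "\<dots> = integral\<^sup>L (?M s) (\<lambda>g. 6 + E g + (L 7 g + L 9 g))"
      by (simp add: set_length_def E_def L_def)
    also have "\<dots> = 6 + integral\<^sup>L (?M s) E + (integral\<^sup>L (?M s) (L 7) + integral\<^sup>L (?M s) (L 9))"
      using iE iL prob_space by simp
    finally show ?thesis by (simp add: L)
  qed
  have "measure (?M PlayerA) {g. both_at_most 5 7 g} < measure (?M PlayerB) {g. both_at_most 5 7 g}"
    using both_at_most_prob_less[OF q ab, of 3 5] by simp
  moreover have "measure (?M PlayerA) {g. both_at_most 5 9 g} < measure (?M PlayerB) {g. both_at_most 5 9 g}"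
    using both_at_most_prob_less[OF q ab, of 4 5] by simp
  ultimately show ?thesis
    by (simp add: split E_eq)
qed

end
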